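(* Let $n\ge 2$, let $F=GF(2^n)$, and let $\vartheta$ be the Frobenius automorphism of $F$, i.e. $\vartheta(x)=x^2$ for all $x\in F$. Let $A(n,\vartheta)$ be the group $$\left\{U(a,b)=\begin{bmatrix}1&0&0\\ a&1&0\\ b&\vartheta(a)&1\end{bmatrix} : a,b\in F\right\}$$ under matrix multiplication, which is given by $U(a,b)U(a',b')=U(a+a',\,b+b'+a'\vartheta(a))$. Then $$\text{L-Spec}(\Gamma_{A(n,\vartheta)})=\{0^{2^n-1},\ (2^n)^{2^{2n}-2^{n+1}+1}\}$$ and $$\text{Q-Spec}(\Gamma_{A(n,\vartheta)})=\{(2^{n+1}-2)^{2^n-1},\ (2^n-2)^{2^{2n}-2^{n+1}+1}\}.$$
   Context: The commuting graph $\Gamma_G$ of a finite non-abelian group $G$ with center $Z(G)$ is the simple undirected graph with vertex set $G\setminus Z(G)$ in which two distinct vertices $x,y$ are adjacent if and only if $xy=yx$. For a finite graph $\mathcal{G}$ with adjacency matrix $A$ and (diagonal) degree matrix $D$, $\text{L-Spec}(\mathcal{G})$ and $\text{Q-Spec}(\mathcal{G})$ denote the multisets of eigenvalues (with multiplicity) of the Laplacian matrix $D-A$ and of the signless Laplacian matrix $D+A$, respectively. The notation $\{\alpha_1^{a_1},\dots,\alpha_l^{a_l}\}$ means the multiset in which $\alpha_i$ is listed $a_i$ times (the outermost exponent is the multiplicity). *)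

theory Defs
  imports
    "Jordan_Normal_Form.Char_Poly"
    "Graph_Theory.Pair_Digraph"
begin

section \<open>Spectra of finite graphs\<close>

text \<open>
  Simple undirected graphs are symmetric loop-free digraphs without parallel arcs, i.e. the
  \<open>pair_graph\<close>s of \<open>Graph_Theory\<close>; the degree of a vertex is then its out-degree.
  The matrices are formed with respect to an enumeration \<open>vs\<close> of the vertices.
\<close>

definition adjacency_matrix :: "'a pair_pre_digraph \<Rightarrow> 'a list \<Rightarrow> real mat" where
  "adjacency_matrix \<Gamma> vs =
     mat (length vs) (length vs) (\<lambda>(i, j). if (vs ! i, vs ! j) \<in> parcs \<Gamma> then 1 else 0)"

definition degree_matrix :: "'a pair_pre_digraph \<Rightarrow> 'a list \<Rightarrow> real mat" where
  "degree_matrix \<Gamma> vs =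
     mat (length vs) (length vs)
       (\<lambda>(i, j). if i = j then real (out_degree (with_proj \<Gamma>) (vs ! i)) else 0)"

definition laplacian_matrix :: "'a pair_pre_digraph \<Rightarrow> 'a list \<Rightarrow> real mat" where
  "laplacian_matrix \<Gamma> vs = degree_matrix \<Gamma> vs - adjacency_matrix \<Gamma> vs"

definition signless_laplacian_matrix :: "'a pair_pre_digraph \<Rightarrow> 'a list \<Rightarrow> real mat" where
  "signless_laplacian_matrix \<Gamma> vs = degree_matrix \<Gamma> vs + adjacency_matrix \<Gamma> vs"

text \<open>
  Eigenvalues are counted with algebraic multiplicity. For a simple graph both matrices are real
  symmetric, so all their complex eigenvalues are real and none is lost by taking real roots.
\<close>

definition eigenvalue_mset :: "real mat \<Rightarrow> real multiset" where
  "eigenvalue_mset A = proots (char_poly A)"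

definition vertex_enumeration :: "'a pair_pre_digraph \<Rightarrow> 'a list" where
  "vertex_enumeration \<Gamma> = (SOME vs. distinct vs \<and> set vs = pverts \<Gamma>)"

definition L_Spec :: "'a pair_pre_digraph \<Rightarrow> real multiset" where
  "L_Spec \<Gamma> = eigenvalue_mset (laplacian_matrix \<Gamma> (vertex_enumeration \<Gamma>))"

definition Q_Spec :: "'a pair_pre_digraph \<Rightarrow> real multiset" where
  "Q_Spec \<Gamma> = eigenvalue_mset (signless_laplacian_matrix \<Gamma> (vertex_enumeration \<Gamma>))"

text \<open>The spectra do not depend on the chosen enumeration.\<close>

lemma vertex_enumeration:
  assumes "finite (pverts \<Gamma>)"
  shows "distinct (vertex_enumeration \<Gamma>)" "set (vertex_enumeration \<Gamma>) = pverts \<Gamma>"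
proof -
  have "\<exists>vs. distinct vs \<and> set vs = pverts \<Gamma>"
    using finite_distinct_list[OF assms] by blast
  then have "distinct (vertex_enumeration \<Gamma>) \<and> set (vertex_enumeration \<Gamma>) = pverts \<Gamma>"
    unfolding vertex_enumeration_def by (rule someI_ex)
  then show "distinct (vertex_enumeration \<Gamma>)" "set (vertex_enumeration \<Gamma>) = pverts \<Gamma>"
    by auto
qed

lemma det_permute_both:
  assumes A: "(A :: 'a :: comm_ring_1 mat) \<in> carrier_mat n n" and p: "p permutes {0..<n}"
  shows "det (mat n n (\<lambda>(i, j). A $$ (p i, p j))) = det A"
proof -
  have lt: "p i < n" if "i < n" for i
    using permutes_in_image[OF p, of i] that by auto
  let ?B = "mat n n (\<lambda>(i, j). A\<^sup>T $$ (p i, j))"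
  have "mat n n (\<lambda>(i, j). A $$ (p i, p j)) = mat n n (\<lambda>(i, j). ?B\<^sup>T $$ (p i, j))"
    using A lt by (intro eq_matI) auto
  also have "det \<dots> = signof p * det (?B\<^sup>T)"
    by (rule det_permute_rows[OF _ p]) simp
  also have "det (?B\<^sup>T) = det ?B"
    by (rule det_transpose[of _ n]) simp
  also have "det ?B = signof p * det (A\<^sup>T)"
    by (rule det_permute_rows[OF _ p]) (use A in simp)
  also have "det (A\<^sup>T) = det A"
    by (rule det_transpose[OF A])
  also have "signof p * (signof p * det A) = det A"
    by (cases "evenperm p") (simp_all add: sign_def)
  finally show ?thesis .
qed

lemma eigenvalue_mset_permute:
  assumes A: "A \<in> carrier_mat n n" and p: "p permutes {0..<n}"
  shows "eigenvalue_mset (mat n n (\<lambda>(i, j). A $$ (p i, p j))) = eigenvalue_mset A"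
proof -
  have lt: "p i < n" if "i < n" for i
    using permutes_in_image[OF p, of i] that by auto
  have eq: "p i = p j \<longleftrightarrow> i = j" for i j
    using permutes_inj[OF p] by (auto dest: injD)
  have "char_poly_matrix (mat n n (\<lambda>(i, j). A $$ (p i, p j)))
      = mat n n (\<lambda>(i, j). char_poly_matrix A $$ (p i, p j))"
    using A lt eq by (intro eq_matI) (auto simp: char_poly_matrix_def)
  then show ?thesis
    unfolding eigenvalue_mset_def char_poly_def
    using det_permute_both[of "char_poly_matrix A" n p] A p by simp
qed

lemma spectrum_enumeration_independent:
  assumes vs: "distinct vs" "set vs = pverts \<Gamma>"
  shows "L_Spec \<Gamma> = eigenvalue_mset (laplacian_matrix \<Gamma> vs)"
    and "Q_Spec \<Gamma> = eigenvalue_mset (signless_laplacian_matrix \<Gamma> vs)"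
proof -
  let ?ws = "vertex_enumeration \<Gamma>"
  let ?n = "length vs"
  have "finite (pverts \<Gamma>)" using vs by (metis List.finite_set)
  from vertex_enumeration[OF this] have "mset ?ws = mset vs"
    using vs set_eq_iff_mset_eq_distinct by metis
  then obtain p where p: "p permutes {..<?n}" and ws: "permute_list p vs = ?ws"
    by (rule mset_eq_permutation)
  have len: "length ?ws = ?n" using ws by (metis length_permute_list)
  have p': "p permutes {0..<?n}" using p by (simp add: lessThan_atLeast0)
  have nth: "?ws ! i = vs ! p i" if "i < ?n" for i
    using permute_list_nth[OF p that] ws by simp
  have lt: "p i < ?n" if "i < ?n" for i
    using permutes_in_image[OF p, of i] that by auto
  have eq: "p i = p j \<longleftrightarrow> i = j" for i j
    using permutes_inj[OF p] by (auto dest: injD)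
  note defs = laplacian_matrix_def signless_laplacian_matrix_def degree_matrix_def
    adjacency_matrix_def
  have carr: "laplacian_matrix \<Gamma> vs \<in> carrier_mat ?n ?n"
    "signless_laplacian_matrix \<Gamma> vs \<in> carrier_mat ?n ?n"
    by (auto simp: defs)
  have "laplacian_matrix \<Gamma> ?ws = mat ?n ?n (\<lambda>(i, j). laplacian_matrix \<Gamma> vs $$ (p i, p j))"
    by (intro eq_matI) (auto simp: defs len nth lt eq)
  then show "L_Spec \<Gamma> = eigenvalue_mset (laplacian_matrix \<Gamma> vs)"
    unfolding L_Spec_def
    using eigenvalue_mset_permute[OF carr(1) p'] by simp
  have "signless_laplacian_matrix \<Gamma> ?ws
      = mat ?n ?n (\<lambda>(i, j). signless_laplacian_matrix \<Gamma> vs $$ (p i, p j))"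
    by (intro eq_matI) (auto simp: defs len nth lt eq)
  then show "Q_Spec \<Gamma> = eigenvalue_mset (signless_laplacian_matrix \<Gamma> vs)"
    unfolding Q_Spec_def
    using eigenvalue_mset_permute[OF carr(2) p'] by simp
qed


section \<open>Commuting graphs\<close>

definition group_center :: "('a, 'b) monoid_scheme \<Rightarrow> 'a set" where
  "group_center G = {z \<in> carrier G. \<forall>x \<in> carrier G. z \<otimes>\<^bsub>G\<^esub> x = x \<otimes>\<^bsub>G\<^esub> z}"

definition commuting_graph :: "('a, 'b) monoid_scheme \<Rightarrow> 'a pair_pre_digraph" where
  "commuting_graph G =
     \<lparr>pverts = carrier G - group_center G,
      parcs = {(x, y). x \<in> carrier G - group_center G \<and> y \<in> carrier G - group_center G \<and>
                       x \<noteq> y \<and> x \<otimes>\<^bsub>G\<^esub> y = y \<otimes>\<^bsub>G\<^esub> x}\<rparr>"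

lemma pair_graph_commuting_graph:
  assumes "finite (carrier G)"
  shows "pair_graph (commuting_graph G)"
proof
  have "parcs (commuting_graph G) \<subseteq> carrier G \<times> carrier G"
    by (auto simp: commuting_graph_def)
  then show "finite (parcs (commuting_graph G))"
    using assms by (meson finite_SigmaI finite_subset)
  show "symmetric (with_proj (commuting_graph G))"
    by (auto simp: symmetric_def sym_def commuting_graph_def)
qed (use assms in \<open>auto simp: commuting_graph_def\<close>)


section \<open>The groups \<open>A(n, \<theta>)\<close>\<close>

definition U :: "('f :: field \<Rightarrow> 'f) \<Rightarrow> 'f \<Rightarrow> 'f \<Rightarrow> 'f mat" where
  "U \<theta> a b = mat_of_rows_list 3
     [[1, 0,   0],
      [a, 1,   0],
      [b, \<theta> a, 1]]"

text \<open>The parameter \<open>n\<close> is implicit in the field: \<open>card (UNIV :: 'f set) = 2 ^ n\<close>.\<close>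

definition A_group :: "('f :: field \<Rightarrow> 'f) \<Rightarrow> 'f mat monoid" where
  "A_group \<theta> = \<lparr>carrier = {U \<theta> a b | a b. True}, monoid.mult = (*), one = 1\<^sub>m 3\<rparr>"

lemma U_mult:
  assumes "\<And>x y. \<theta> (x + y) = \<theta> x + \<theta> y"
  shows "U \<theta> a b * U \<theta> a' b' = U \<theta> (a + a') (b + b' + a' * \<theta> a)"
  by (rule eq_matI)
    (auto simp: U_def mat_of_rows_list_def scalar_prod_def assms numeral_3_eq_3 less_Suc_eq
      algebra_simps)

lemma group_A_group:
  assumes add: "\<And>x y. \<theta> (x + y) = \<theta> x + \<theta> y"
  shows "group (A_group \<theta>)"
proof -
  have \<theta>0: "\<theta> 0 = 0" using add[of 0 0] by (metis add_0_right add_left_cancel)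
  have one: "1\<^sub>m 3 = U \<theta> 0 0"
    by (rule eq_matI)
      (auto simp: U_def mat_of_rows_list_def \<theta>0 numeral_3_eq_3 less_Suc_eq)
  have carr: "U \<theta> a b \<in> carrier_mat 3 3" for a b
    by (auto simp: U_def mat_of_rows_list_def)
  show ?thesis
  proof (rule groupI)
    fix x y assume "x \<in> carrier (A_group \<theta>)" "y \<in> carrier (A_group \<theta>)"
    then show "x \<otimes>\<^bsub>A_group \<theta>\<^esub> y \<in> carrier (A_group \<theta>)"
      by (auto simp: A_group_def U_mult[OF add]) blast
  next
    show "\<one>\<^bsub>A_group \<theta>\<^esub> \<in> carrier (A_group \<theta>)"
      by (auto simp: A_group_def one)
  next
    fix x y z
    assume "x \<in> carrier (A_group \<theta>)" "y \<in> carrier (A_group \<theta>)" "z \<in> carrier (A_group \<theta>)"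
    then show "x \<otimes>\<^bsub>A_group \<theta>\<^esub> y \<otimes>\<^bsub>A_group \<theta>\<^esub> z = x \<otimes>\<^bsub>A_group \<theta>\<^esub> (y \<otimes>\<^bsub>A_group \<theta>\<^esub> z)"
      using carr by (auto simp: A_group_def intro!: assoc_mult_mat[of _ 3 3 _ 3 _ 3])
  next
    fix x assume "x \<in> carrier (A_group \<theta>)"
    then show "\<one>\<^bsub>A_group \<theta>\<^esub> \<otimes>\<^bsub>A_group \<theta>\<^esub> x = x"
      by (auto simp: A_group_def left_mult_one_mat[OF carr])
  next
    fix x assume "x \<in> carrier (A_group \<theta>)"
    then obtain a b where x: "x = U \<theta> a b" by (auto simp: A_group_def)
    have "\<theta> (- a) = - \<theta> a"
      using add[of a "- a"] \<theta>0 by (simp add: eq_neg_iff_add_eq_0 add.commute)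
    then have "U \<theta> (- a) (a * \<theta> a - b) * U \<theta> a b = U \<theta> 0 0"
      by (simp add: U_mult[OF add])
    then show "\<exists>y \<in> carrier (A_group \<theta>). y \<otimes>\<^bsub>A_group \<theta>\<^esub> x = \<one>\<^bsub>A_group \<theta>\<^esub>"
      unfolding x by (auto simp: A_group_def one)
  qed
qed

lemma frobenius_add:
  fixes x y :: "'f :: field"
  assumes "card (UNIV :: 'f set) = 2 ^ n"
  shows "(x + y) ^ 2 = x ^ 2 + y ^ 2"
proof -
  have "finite (UNIV :: 'f set)"
    using assms by (intro card_ge_0_finite) simp
  have "(\<Sum>z \<in> (UNIV :: 'f set). z) = (\<Sum>z \<in> UNIV. z + 1)"
    by (rule sum.reindex_bij_witness[of _ "\<lambda>z. z + 1" "\<lambda>z. z - 1"]) auto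
  also have "\<dots> = (\<Sum>z \<in> UNIV. z) + of_nat (card (UNIV :: 'f set))"
    by (simp add: sum.distrib)
  finally have "of_nat (2 ^ n) = (0 :: 'f)" using assms by simp
  then have "(2 :: 'f) = 0" by simp
  then show ?thesis by (simp add: power2_sum)
qed

end

theory Submission
  imports Defs
begin

text \<open>
  If \<open>U a b\<close> and \<open>U a' b'\<close> lie outside the centre, then \<open>a, a' \<noteq> 0\<close>, and they commute iff
  \<open>a' a\<^sup>2 = a a'\<^sup>2\<close>, i.e. \<open>a = a'\<close>. So the commuting graph is a disjoint union of
  \<open>2 ^ n - 1\<close> cliques of size \<open>2 ^ n\<close>. For \<open>m\<close> cliques of size \<open>k\<close> the adjacency matrix is
  \<open>P P\<^sup>T - I\<close>, where \<open>P\<close> is the vertex-clique incidence matrix and \<open>P\<^sup>T P = k I\<^sub>m\<close>, and the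
  characteristic polynomials of \<open>P P\<^sup>T\<close> and \<open>P\<^sup>T P\<close> agree up to a power of the variable.
\<close>

section \<open>Determinants and characteristic polynomials\<close>

text \<open>This is Sylvester's determinant identity without division. Two block matrices are
  multiplied in both orders; each product is block upper triangular, and the two determinants agree.
  The powers of \<open>y\<close> stand in for division by \<open>y\<close>, which will be a
  non-constant polynomial.\<close>

lemma det_smult_one_minus_mult_commute:
  fixes C D :: "'a :: idom mat"
  assumes C: "C \<in> carrier_mat N m" and D: "D \<in> carrier_mat m N"
  shows "y ^ m * det (y \<cdot>\<^sub>m 1\<^sub>m N - C * D) = y ^ N * det (y \<cdot>\<^sub>m 1\<^sub>m m - D * C)"
proof -
  \<comment> \<open>The first block column of \<open>?R\<close> clears the lower left block of
    \<open>?P * ?R\<close>. Since \<open>y\<close> is a scalar, the same block also vanishes in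
    \<open>?R * ?P\<close>.\<close>
  let ?P = "four_block_mat (y \<cdot>\<^sub>m 1\<^sub>m N) C D (1\<^sub>m m)"
  let ?R = "four_block_mat (1\<^sub>m N) (0\<^sub>m N m) (- D) (y \<cdot>\<^sub>m 1\<^sub>m m)"
  have P: "?P \<in> carrier_mat (N + m) (N + m)" and R: "?R \<in> carrier_mat (N + m) (N + m)"
    by auto
  have CD: "C * D \<in> carrier_mat N N" and DC: "D * C \<in> carrier_mat m m"
    using C D by auto
  have one_mult: "(y \<cdot>\<^sub>m 1\<^sub>m k) * A = y \<cdot>\<^sub>m A" "A * (y \<cdot>\<^sub>m 1\<^sub>m l) = y \<cdot>\<^sub>m A"
    if "A \<in> carrier_mat k l" for A k l
    using that mult_smult_assoc_mat[of "1\<^sub>m k" k k A l y] mult_smult_distrib[of A k l "1\<^sub>m l" l y]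
    by simp_all
  have "?P * ?R = four_block_mat (y \<cdot>\<^sub>m 1\<^sub>m N * 1\<^sub>m N + C * - D)
      (y \<cdot>\<^sub>m 1\<^sub>m N * 0\<^sub>m N m + C * (y \<cdot>\<^sub>m 1\<^sub>m m)) (D * 1\<^sub>m N + 1\<^sub>m m * - D)
      (D * 0\<^sub>m N m + 1\<^sub>m m * (y \<cdot>\<^sub>m 1\<^sub>m m))"
    by (rule mult_four_block_mat) (use C D in auto)
  also have "y \<cdot>\<^sub>m 1\<^sub>m N * 1\<^sub>m N + C * - D = y \<cdot>\<^sub>m 1\<^sub>m N - C * D"
    using C D CD by (simp add: minus_add_uminus_mat[of _ N N])
  also have "y \<cdot>\<^sub>m 1\<^sub>m N * 0\<^sub>m N m + C * (y \<cdot>\<^sub>m 1\<^sub>m m) = y \<cdot>\<^sub>m C"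
    using C by (simp add: one_mult[OF C])
  also have "D * 1\<^sub>m N + 1\<^sub>m m * - D = 0\<^sub>m m N"
    using D by (auto intro!: eq_matI)
  also have "D * 0\<^sub>m N m + 1\<^sub>m m * (y \<cdot>\<^sub>m 1\<^sub>m m) = y \<cdot>\<^sub>m 1\<^sub>m m"
    using D by simp
  finally have "?P * ?R = four_block_mat (y \<cdot>\<^sub>m 1\<^sub>m N - C * D) (y \<cdot>\<^sub>m C) (0\<^sub>m m N) (y \<cdot>\<^sub>m 1\<^sub>m m)" .
  then have det_PR: "det (?P * ?R) = det (y \<cdot>\<^sub>m 1\<^sub>m N - C * D) * y ^ m"
    using det_four_block_mat_lower_left_zero[of "y \<cdot>\<^sub>m 1\<^sub>m N - C * D" N "y \<cdot>\<^sub>m C" m "0\<^sub>m m N" "y \<cdot>\<^sub>m 1\<^sub>m m"]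
      C CD by (simp add: minus_carrier_mat)
  have "?R * ?P = four_block_mat (1\<^sub>m N * (y \<cdot>\<^sub>m 1\<^sub>m N) + 0\<^sub>m N m * D)
      (1\<^sub>m N * C + 0\<^sub>m N m * 1\<^sub>m m) (- D * (y \<cdot>\<^sub>m 1\<^sub>m N) + y \<cdot>\<^sub>m 1\<^sub>m m * D)
      (- D * C + y \<cdot>\<^sub>m 1\<^sub>m m * 1\<^sub>m m)"
    by (rule mult_four_block_mat) (use C D in auto)
  moreover have "1\<^sub>m N * (y \<cdot>\<^sub>m 1\<^sub>m N) + 0\<^sub>m N m * D = y \<cdot>\<^sub>m 1\<^sub>m N"
    using D by simp
  moreover have "1\<^sub>m N * C + 0\<^sub>m N m * 1\<^sub>m m = C"
    using C by simp
  moreover have "- D * (y \<cdot>\<^sub>m 1\<^sub>m N) + y \<cdot>\<^sub>m 1\<^sub>m m * D = 0\<^sub>m m N"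
    using D one_mult(1)[OF D] one_mult(2)[of "- D" m N] by (auto intro!: eq_matI)
  moreover have "- D * C + y \<cdot>\<^sub>m 1\<^sub>m m * 1\<^sub>m m = y \<cdot>\<^sub>m 1\<^sub>m m - D * C"
    using C D DC by (auto intro!: eq_matI)
  ultimately have "?R * ?P = four_block_mat (y \<cdot>\<^sub>m 1\<^sub>m N) C (0\<^sub>m m N) (y \<cdot>\<^sub>m 1\<^sub>m m - D * C)"
    by metis
  then have det_RP: "det (?R * ?P) = y ^ N * det (y \<cdot>\<^sub>m 1\<^sub>m m - D * C)"
    using det_four_block_mat_lower_left_zero[of "y \<cdot>\<^sub>m 1\<^sub>m N" N C m "0\<^sub>m m N" "y \<cdot>\<^sub>m 1\<^sub>m m - D * C"]
      C DC by (simp add: minus_carrier_mat)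
  show ?thesis
    using det_PR det_RP det_mult[OF P R] det_mult[OF R P] by (simp only: mult_ac)
qed

text \<open>With \<open>P\<close> the incidence matrix of indices and fibres, \<open>M\<close> is a
  scalar matrix plus \<open>s\<close> times \<open>P\<close> times its transpose. Swapping the two
  factors leaves an \<open>m\<close> by \<open>m\<close> scalar matrix, because the fibres are
  disjoint and all have size \<open>k\<close>.\<close>

lemma char_poly_equal_fibres:
  fixes a s :: "'a :: idom" and g :: "nat \<Rightarrow> nat"
  assumes g: "\<And>i. i < N \<Longrightarrow> g i < m"
    and fibre: "\<And>c. c < m \<Longrightarrow> card {i \<in> {0..<N}. g i = c} = k"
  defines "M \<equiv> mat N N (\<lambda>(i, j). (if i = j then a else 0) + (if g i = g j then s else 0))"
  shows "[:- a, 1:] ^ m * char_poly M = [:- a, 1:] ^ N * [:- (a + s * of_nat k), 1:] ^ m"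
proof -
  \<comment> \<open>The determinant identity is used over the polynomial ring at
    \<open>y = X - a\<close>, so the entries are constant polynomials; the factor \<open>s\<close>
    is absorbed into \<open>?C\<close>.\<close>
  let ?C = "mat N m (\<lambda>(i, c). if g i = c then [:s:] else 0)"
  let ?D = "mat m N (\<lambda>(c, i). if g i = c then 1 else 0) :: 'a poly mat"
  let ?y = "[:- a, 1:]"
  have CD: "(?C * ?D) $$ (i, j) = (if g i = g j then [:s:] else 0)" if "i < N" "j < N" for i j
  proof -
    have "(?C * ?D) $$ (i, j)
        = (\<Sum>c = 0..<m. (if g i = c then [:s:] else 0) * (if g j = c then 1 else 0))"
      using that by (simp add: scalar_prod_def)
    also have "\<dots> = (\<Sum>c = 0..<m. if c = g i then (if g i = g j then [:s:] else 0) else 0)"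
      by (rule sum.cong) auto
    finally show ?thesis using g[OF that(1)] by simp
  qed
  have DC: "(?D * ?C) $$ (c, d) = (if c = d then [:s * of_nat k:] else 0)"
    if "c < m" "d < m" for c d
  proof -
    have "(?D * ?C) $$ (c, d)
        = (\<Sum>i = 0..<N. (if g i = c then 1 else 0) * (if g i = d then [:s:] else 0))"
      using that by (simp add: scalar_prod_def)
    also have "\<dots> = (\<Sum>i = 0..<N. if g i = c then (if c = d then [:s:] else 0) else 0)"
      by (rule sum.cong) auto
    also have "\<dots> = (\<Sum>i \<in> {i \<in> {0..<N}. g i = c}. if c = d then [:s:] else 0)"
      by (rule sum.inter_filter[symmetric]) simp
    finally show ?thesis
      using fibre[OF that(1)] by (simp add: of_nat_poly mult.commute)
  qed
  have "char_poly_matrix M = ?y \<cdot>\<^sub>m 1\<^sub>m N - ?C * ?D"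
    by (rule eq_matI) (auto simp: char_poly_matrix_def M_def CD simp del: index_mult_mat(1))
  moreover have "?y \<cdot>\<^sub>m 1\<^sub>m m - ?D * ?C = [:- (a + s * of_nat k), 1:] \<cdot>\<^sub>m 1\<^sub>m m"
    by (rule eq_matI) (auto simp: DC simp del: index_mult_mat(1))
  ultimately show ?thesis
    using det_smult_one_minus_mult_commute[of ?C N m ?D ?y] by (simp add: char_poly_def)
qed

text \<open>The common factor \<open>[:- a, 1:] ^ m\<close> is nonzero and can be cancelled;
  \<open>m \<le> N\<close> makes the exponent \<open>N - m\<close> a true difference.\<close>

lemma eigenvalue_mset_equal_fibres:
  fixes a s :: real and g :: "nat \<Rightarrow> nat"
  assumes g: "\<And>i. i < N \<Longrightarrow> g i < m"
    and fibre: "\<And>c. c < m \<Longrightarrow> card {i \<in> {0..<N}. g i = c} = k"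
    and "m \<le> N"
  shows "eigenvalue_mset
      (mat N N (\<lambda>(i, j). (if i = j then a else 0) + (if g i = g j then s else 0)))
    = replicate_mset m (a + s * real k) + replicate_mset (N - m) a" (is "eigenvalue_mset ?M = _")
proof -
  let ?y = "[:- a, 1:]" and ?z = "[:- (a + s * real k), 1:]"
  have "?y ^ m * char_poly ?M = ?y ^ m * (?y ^ (N - m) * ?z ^ m)"
    using char_poly_equal_fibres[of N g m k a s, OF g fibre] \<open>m \<le> N\<close>
    by (simp add: mult.assoc[symmetric] power_add[symmetric])
  then have "char_poly ?M = ?y ^ (N - m) * ?z ^ m"
    by (simp only: mult_cancel_left) simp
  moreover have "proots [:- c, 1:] = {#c#}" for c :: real
    using proots_linear_factor[of "-c"] by simp
  ultimately show ?thesis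
    unfolding eigenvalue_mset_def
    by (simp only:) (subst proots_mult, simp_all add: proots_power add.commute)
qed

section \<open>Disjoint unions of cliques of equal size\<close>

text \<open>The value of \<open>f\<close> names the clique of a vertex. Every degree is
  \<open>k - 1\<close>, so both matrices have the equal-fibre form: the Laplacian with
  \<open>a = k\<close>, \<open>s = -1\<close>, the signless one with \<open>a = k - 2\<close>,
  \<open>s = 1\<close>.\<close>

lemma spectra_disjoint_cliques:
  fixes \<Gamma> :: "'a pair_pre_digraph" and f :: "'a \<Rightarrow> 'b"
  assumes fin: "finite (pverts \<Gamma>)"
    and arcs: "parcs \<Gamma> = {(x, y). x \<in> pverts \<Gamma> \<and> y \<in> pverts \<Gamma> \<and> x \<noteq> y \<and> f x = f y}"
    and clique: "\<And>c. c \<in> f ` pverts \<Gamma> \<Longrightarrow> card {x \<in> pverts \<Gamma>. f x = c} = k"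
  defines "m \<equiv> card (f ` pverts \<Gamma>)"
  shows "L_Spec \<Gamma> = replicate_mset m 0 + replicate_mset (card (pverts \<Gamma>) - m) (real k)"
    and "Q_Spec \<Gamma> =
      replicate_mset m (2 * real k - 2) + replicate_mset (card (pverts \<Gamma>) - m) (real k - 2)"
proof -
  define vs where "vs = vertex_enumeration \<Gamma>"
  have vs: "distinct vs" "set vs = pverts \<Gamma>"
    using vertex_enumeration[OF fin] by (simp_all add: vs_def)
  define N where "N = length vs"
  have N: "N = card (pverts \<Gamma>)"
    using vs distinct_card by (fastforce simp: N_def)
  have vs_in: "vs ! i \<in> pverts \<Gamma>" if "i < N" for i
    using that nth_mem[of i vs] vs(2) by (simp add: N_def)
  \<comment> \<open>Numbering the cliques turns \<open>f\<close> into a map \<open>g\<close> between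
    indices, as the matrix lemma requires.\<close>
  obtain h where h: "bij_betw h (f ` pverts \<Gamma>) {0..<m}"
    using ex_bij_betw_finite_nat fin unfolding m_def by blast
  define g where "g i = h (f (vs ! i))" for i
  have g: "g i < m" if "i < N" for i
    using h vs_in[OF that] by (auto simp: g_def bij_betw_def)
  have g_eq: "g i = g j \<longleftrightarrow> f (vs ! i) = f (vs ! j)" if "i < N" "j < N" for i j
    using h vs_in[OF that(1)] vs_in[OF that(2)] by (auto simp: g_def bij_betw_def inj_on_def)
  have vs_eq: "vs ! i = vs ! j \<longleftrightarrow> i = j" if "i < N" "j < N" for i j
    using that vs by (simp add: N_def nth_eq_iff_index_eq)
  have fibre: "card {i \<in> {0..<N}. g i = c} = k" if "c < m" for c
  proof -
    have "c \<in> h ` f ` pverts \<Gamma>"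
      using bij_betw_imp_surj_on[OF h] that by simp
    then obtain b where b: "b \<in> f ` pverts \<Gamma>" "h b = c" by blast
    have iff: "h (f x) = c \<longleftrightarrow> f x = b" if "x \<in> pverts \<Gamma>" for x
      using inj_on_eq_iff[OF bij_betw_imp_inj_on[OF h], of "f x" b] b that by simp
    have "bij_betw ((!) vs) {i \<in> {0..<N}. g i = c} {x \<in> pverts \<Gamma>. f x = b}"
      unfolding bij_betw_def
    proof
      show "inj_on ((!) vs) {i \<in> {0..<N}. g i = c}"
        by (auto simp: inj_on_def vs_eq)
      show "(!) vs ` {i \<in> {0..<N}. g i = c} = {x \<in> pverts \<Gamma>. f x = b}"
      proof safe
        fix i assume "i \<in> {0..<N}"
        then have i: "vs ! i \<in> pverts \<Gamma>" by (simp add: vs_in)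
        then show "vs ! i \<in> pverts \<Gamma>" .
        show "f (vs ! i) = b" if "c = g i"
          using iff[OF i] that by (simp add: g_def)
      next
        fix x assume x: "x \<in> pverts \<Gamma>" "b = f x"
        then obtain i where "i < N" "vs ! i = x"
          using vs(2) unfolding N_def by (metis in_set_conv_nth)
        then show "x \<in> (!) vs ` {i \<in> {0..<N}. g i = c}"
          using iff[OF x(1)] x(2) by (auto simp: g_def)
      qed
    qed
    then show ?thesis using clique[OF b(1)] by (simp add: bij_betw_same_card)
  qed
  have "m \<le> N" using fin by (simp add: m_def N card_image_le)
  have deg: "real (out_degree (with_proj \<Gamma>) x) = real k - 1" if x: "x \<in> pverts \<Gamma>" for x
  proof -
    have "out_arcs (with_proj \<Gamma>) x = Pair x ` ({y \<in> pverts \<Gamma>. f y = f x} - {x})"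
      using x by (auto simp: out_arcs_def arcs)
    then have "out_degree (with_proj \<Gamma>) x = card ({y \<in> pverts \<Gamma>. f y = f x} - {x})"
      by (simp add: out_degree_def card_image inj_on_def)
    also have "\<dots> = k - 1"
      using x clique[of "f x"] by simp
    \<comment> \<open>The clique contains \<open>x\<close> itself. Positivity makes the truncated
      \<open>k - 1\<close> agree with the real difference.\<close>
    moreover have "0 < k"
      using x clique[of "f x"] fin by (auto simp: card_gt_0_iff)
    ultimately show ?thesis by simp
  qed
  \<comment> \<open>The fibre term also hits the diagonal, where the adjacency matrix is 0. Hence
    the diagonal coefficient is \<open>k\<close> rather than \<open>k - 1\<close>, and
    \<open>k - 2\<close> in the signless case.\<close>
  have "laplacian_matrix \<Gamma> vs =
      mat N N (\<lambda>(i, j). (if i = j then real k else 0) + (if g i = g j then - 1 else 0))"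
    by (rule eq_matI)
      (auto simp: laplacian_matrix_def degree_matrix_def adjacency_matrix_def N_def[symmetric]
        arcs deg vs_in g_eq vs_eq)
  then show "L_Spec \<Gamma> = replicate_mset m 0 + replicate_mset (card (pverts \<Gamma>) - m) (real k)"
    using eigenvalue_mset_equal_fibres[of N g m k "real k" "- 1", OF g fibre \<open>m \<le> N\<close>]
    by (simp add: L_Spec_def vs_def[symmetric] N)
  have "signless_laplacian_matrix \<Gamma> vs =
      mat N N (\<lambda>(i, j). (if i = j then real k - 2 else 0) + (if g i = g j then 1 else 0))"
    by (rule eq_matI)
      (auto simp: signless_laplacian_matrix_def degree_matrix_def adjacency_matrix_def
        N_def[symmetric] arcs deg vs_in g_eq vs_eq)
  then show "Q_Spec \<Gamma> =
      replicate_mset m (2 * real k - 2) + replicate_mset (card (pverts \<Gamma>) - m) (real k - 2)"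
    using eigenvalue_mset_equal_fibres[of N g m k "real k - 2" 1, OF g fibre \<open>m \<le> N\<close>]
    by (simp add: Q_Spec_def vs_def[symmetric] N)
qed

section \<open>The commuting graph of the matrix group\<close>

lemma U_eq_iff: "U \<theta> a b = U \<theta> a' b' \<longleftrightarrow> a = a' \<and> b = b'"
proof
  assume eq: "U \<theta> a b = U \<theta> a' b'"
  have "U \<theta> a b $$ (1, 0) = a" "U \<theta> a b $$ (2, 0) = b" for a b
    by (simp_all add: U_def mat_of_rows_list_def)
  then show "a = a' \<and> b = b'" using eq by metis
qed simp

theorem proposition2p13:
  fixes n :: nat and \<theta> :: "'f :: field \<Rightarrow> 'f"
  assumes "n \<ge> 2"
    and "card (UNIV :: 'f set) = 2 ^ n"
    and "\<And>x. \<theta> x = x ^ 2"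
  shows "L_Spec (commuting_graph (A_group \<theta>)) =
           replicate_mset (2 ^ n - 1) 0 +
           replicate_mset (2 ^ (2 * n) - 2 ^ (n + 1) + 1) (2 ^ n)
       \<and> Q_Spec (commuting_graph (A_group \<theta>)) =
           replicate_mset (2 ^ n - 1) (2 ^ (n + 1) - 2) +
           replicate_mset (2 ^ (2 * n) - 2 ^ (n + 1) + 1) (2 ^ n - 2)"
proof -
  let ?G = "A_group \<theta>" and ?\<Gamma> = "commuting_graph (A_group \<theta>)"
  define f :: "'f mat \<Rightarrow> 'f" where "f M = M $$ (1, 0)" for M
  have f: "f (U \<theta> a b) = a" for a b
    by (simp add: f_def U_def mat_of_rows_list_def)
  have fin: "finite (UNIV :: 'f set)"
    using assms(2) by (intro card_ge_0_finite) simp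
  have add: "\<theta> (x + y) = \<theta> x + \<theta> y" for x y
    by (simp add: assms(3) frobenius_add[OF assms(2)])
  \<comment> \<open>The terms \<open>b + b'\<close> cancel, leaving
    \<open>a' * a^2 = a * a'^2\<close>, that is \<open>a * a' * (a - a') = 0\<close>.\<close>
  have comm: "U \<theta> a b * U \<theta> a' b' = U \<theta> a' b' * U \<theta> a b \<longleftrightarrow> a = 0 \<or> a' = 0 \<or> a = a'"
    for a b a' b'
    by (auto simp: U_mult[OF add] U_eq_iff assms(3) power2_eq_square add.commute)
  have carrier: "carrier ?G = (\<lambda>(a, b). U \<theta> a b) ` UNIV"
    by (auto simp: A_group_def)
  have center: "U \<theta> a b \<in> group_center ?G \<longleftrightarrow> a = 0" for a b
  proof
    \<comment> \<open>As \<open>n \<ge> 2\<close>, the field has at least four elements, so some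
      \<open>c\<close> avoids both 0 and \<open>a\<close>. Commuting with
      \<open>U \<theta> c 0\<close> then forces \<open>a = 0\<close>.\<close>
    have "(2::nat) ^ 2 \<le> 2 ^ n" using assms(1) by (intro power_increasing) auto
    then have "card {0, a} < card (UNIV :: 'f set)"
      using card_insert_le_m1[of 2 "{a}" 0] assms(2) by simp
    then have "{0, a} \<noteq> UNIV" by auto
    then obtain c where "c \<noteq> 0" "c \<noteq> a" by blast
    moreover assume "U \<theta> a b \<in> group_center ?G"
    then have "U \<theta> a b * U \<theta> c 0 = U \<theta> c 0 * U \<theta> a b"
      by (auto simp: group_center_def A_group_def)
    ultimately show "a = 0" by (simp add: comm)
  next
    assume "a = 0"
    then show "U \<theta> a b \<in> group_center ?G"
      by (auto simp: group_center_def A_group_def comm)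
  qed
  have verts: "pverts ?\<Gamma> = (\<lambda>(a, b). U \<theta> a b) ` ((UNIV - {0}) \<times> UNIV)"
    by (auto simp: commuting_graph_def carrier center)
  have arcs: "parcs ?\<Gamma> = {(x, y). x \<in> pverts ?\<Gamma> \<and> y \<in> pverts ?\<Gamma> \<and> x \<noteq> y \<and> f x = f y}"
  proof -
    have "parcs ?\<Gamma> = {(x, y). x \<in> pverts ?\<Gamma> \<and> y \<in> pverts ?\<Gamma> \<and> x \<noteq> y \<and> x * y = y * x}"
      by (simp add: commuting_graph_def A_group_def)
    \<comment> \<open>Both parameters are nonzero at vertices, so only the third alternative of
      \<open>comm\<close> survives.\<close>
    also have "x * y = y * x \<longleftrightarrow> f x = f y" if "x \<in> pverts ?\<Gamma>" "y \<in> pverts ?\<Gamma>" for x y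
      using that by (auto simp: verts comm f)
    then have "{(x, y). x \<in> pverts ?\<Gamma> \<and> y \<in> pverts ?\<Gamma> \<and> x \<noteq> y \<and> x * y = y * x}
        = {(x, y). x \<in> pverts ?\<Gamma> \<and> y \<in> pverts ?\<Gamma> \<and> x \<noteq> y \<and> f x = f y}"
      by blast
    finally show ?thesis .
  qed
  have inj: "inj_on (\<lambda>(a, b). U \<theta> a b) S" for S
    by (auto simp: inj_on_def U_eq_iff)
  have fin_verts: "finite (pverts ?\<Gamma>)"
    unfolding verts using fin by (intro finite_imageI finite_cartesian_product) auto
  have card_verts: "card (pverts ?\<Gamma>) = (2 ^ n - 1) * 2 ^ n"
    unfolding verts using fin
    by (simp add: card_image[OF inj] card_cartesian_product card_Diff_singleton assms(2))
  have image: "f ` pverts ?\<Gamma> = UNIV - {0}"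
    by (force simp: verts image_image f split: prod.splits)
  have card_image_f: "card (f ` pverts ?\<Gamma>) = 2 ^ n - 1"
    using fin by (simp add: image card_Diff_singleton assms(2))
  have clique: "card {x \<in> pverts ?\<Gamma>. f x = c} = 2 ^ n" if "c \<in> f ` pverts ?\<Gamma>" for c
  proof -
    \<comment> \<open>Here \<open>c\<close> is nonzero, so every \<open>U \<theta> c b\<close> is a
      vertex and the clique is a copy of the field.\<close>
    have "{x \<in> pverts ?\<Gamma>. f x = c} = range (U \<theta> c)"
      using that unfolding image by (auto simp: verts f)
    moreover have "inj (U \<theta> c)" by (simp add: inj_def U_eq_iff)
    ultimately show ?thesis by (simp add: card_image assms(2))
  qed
  have "(2 ^ n - 1) * 2 ^ n - (2 ^ n - 1) = (2 :: nat) ^ (2 * n) - 2 ^ (n + 1) + 1"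
  proof -
    \<comment> \<open>With \<open>q = 2^n - 1\<close> both sides equal \<open>q^2\<close>. The case
      \<open>q = 0\<close> must be excluded, since there the subtraction on the right would be
      truncated.\<close>
    obtain q where q: "(2 :: nat) ^ n = q + 1"
      by (metis Suc_eq_plus1 gr0_implies_Suc zero_less_numeral zero_less_power)
    have "q \<noteq> 0" using q assms(1) by (cases "q = 0") simp_all
    then show ?thesis
      by (cases q) (simp_all add: q power_mult power2_eq_square mult.commute[of 2 n] power_mult)
  qed
  then show ?thesis
    using spectra_disjoint_cliques[OF fin_verts arcs clique] card_verts card_image_f
    by simp
qed

end
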